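(* Let $s\ge1$ and let $a_{ij},b_i$ ($i,j=1,\dots,s$) be arbitrary real numbers. Let $(\boldsymbol{B}^n,\boldsymbol{\rho}^n,\boldsymbol{u}^n,\boldsymbol{\phi}^n)_{n\ge0}$ in $\mathbb{V}_h$ be generated by the fully discrete Runge–Kutta scheme with these coefficients (the scheme described in the context). Then the two discrete linear invariants are conserved: $$\mathcal{I}_{1h}^{n+1}=\mathcal{I}_{1h}^n,\qquad \mathcal{I}_{2h}^{n+1}=\mathcal{I}_{2h}^n,\qquad n=0,1,\dots,$$ where $\mathcal{I}_{1h}^n=\langle\boldsymbol{\rho}^n,\boldsymbol{1}\rangle_h$ and $\mathcal{I}_{2h}^n=\langle\boldsymbol{u}^n,\boldsymbol{1}\rangle_h$.
   Context: $\omega,\kappa,\nu,\beta,q$ are given real constants with $q=\kappa+\frac{\nu(\kappa\nu-1)}{4(\beta-\nu^2)}$ (so $\beta\ne\nu^2$). $\Omega=[a,b]$, $N$ is a positive even integer, $h=(b-a)/N$, $x_j=a+jh$, $\mu=\frac{2\pi}{b-a}$, and $\tau>0$ is the time step. $\mathbb{V}_h$ is the space of periodic mesh functions, written as vectors $\boldsymbol{U}=(U_0,\dots,U_{N-1})^T$; the $\boldsymbol{B}$-variables have complex entries, while the $\boldsymbol{\rho},\boldsymbol{u},\boldsymbol{\phi}$-variables (including internal stages) have real entries. $\langle\boldsymbol{U},\boldsymbol{V}\rangle_h=h\sum_{j=0}^{N-1}U_j\bar V_j$; $\boldsymbol{U}\cdot\boldsymbol{V}$ is the componentwise product; $\boldsymbol{1}=(1,\dots,1)^T\in\mathbb{R}^N$;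 $\mathrm{Re}$ is taken componentwise. Fourier pseudo-spectral differentiation matrices: $(\mathcal{D}_m)_{j,k}=\frac{d^m g_k}{dx^m}(x_j)$, $j,k=0,\dots,N-1$, where $g_j(x)=\frac1N\sum_{l=-N/2}^{N/2}\frac1{c_l}e^{\mathrm{i}l\mu(x-x_j)}$ with $c_l=1$ for $|l|<N/2$ and $c_l=2$ for $|l|=N/2$. Equivalently, $\mathcal{D}_1=\mathcal{F}_N^H\Lambda^1\mathcal{F}_N$ and $\mathcal{D}_2=\mathcal{F}_N^H\Lambda^2\mathcal{F}_N$, with $(\mathcal{F}_N)_{j,k}=\frac1{\sqrt N}e^{-\mathrm{i}jk\frac{2\pi}{N}}$, $\mathcal{F}_N^H$ its conjugate transpose, $\Lambda^1=\mathrm{i}\mu\,\mathrm{diag}(0,1,\dots,\frac N2-1,0,-\frac N2+1,\dots,-1)$ and $\Lambda^2=[\mathrm{i}\mu\,\mathrm{diag}(0,1,\dots,\frac N2-1,\frac N2,-\frac N2+1,\dots,-1)]^2$. Scheme ($s$-stage Runge–Kutta method with real coefficients $b_i,a_{ij}$, and $c_i=\sum_{j=1}^sa_{ij}$): given $\boldsymbol{B}^n,\boldsymbol{\rho}^n,\boldsymbol{u}^n,\boldsymbol{\phi}^n\in\mathbb{V}_h$, the stages satisfy, for $i=1,\dots,s$, $$\begin{aligned}&\boldsymbol{B}_{ni}=\boldsymbol{B}^n+\tau\sum_{j=1}^sa_{ij}k_j^1,& &k_i^1=\mathrm{i}\big(\omega\mathcal{D}_2\boldsymbol{B}_{ni}-\kappa(\boldsymbol{u}_{ni}-\tfrac12\nu\boldsymbol{\rho}_{ni}+q\boldsymbol{\phi}_{ni})\cdot\boldsymbol{B}_{ni}\big),\\&\boldsymbol{\rho}_{ni}=\boldsymbol{\rho}^n+\tau\sum_{j=1}^sa_{ij}k_j^2,&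 &k_i^2=\mathcal{D}_1\big(-\boldsymbol{u}_{ni}+\nu\boldsymbol{\rho}_{ni}-\kappa\boldsymbol{\phi}_{ni}\big),\\&\boldsymbol{u}_{ni}=\boldsymbol{u}^n+\tau\sum_{j=1}^sa_{ij}k_j^3,& &k_i^3=\mathcal{D}_1\big(-\beta\boldsymbol{\rho}_{ni}+\nu\boldsymbol{u}_{ni}+\tfrac12\kappa\nu\boldsymbol{\phi}_{ni}\big),\\&\boldsymbol{\phi}_{ni}=\boldsymbol{\phi}^n+\tau\sum_{j=1}^sa_{ij}k_j^4,& &k_i^4=2\,\mathrm{Re}(\bar{\boldsymbol{B}}_{ni}\cdot k_i^1),\end{aligned}$$ and the update is $\boldsymbol{B}^{n+1}=\boldsymbol{B}^n+\tau\sum_{i=1}^sb_ik_i^1$, $\boldsymbol{\rho}^{n+1}=\boldsymbol{\rho}^n+\tau\sum_{i=1}^sb_ik_i^2$, $\boldsymbol{u}^{n+1}=\boldsymbol{u}^n+\tau\sum_{i=1}^sb_ik_i^3$, $\boldsymbol{\phi}^{n+1}=\boldsymbol{\phi}^n+\tau\sum_{i=1}^sb_ik_i^4$. A sequence is "generated by the scheme" if at each step some stage values satisfying these (implicit) equations exist and give the update. *)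

theory Defs
  imports "HOL-Analysis.Analysis"
begin

text \<open>
  A mesh function with \<open>N\<close> nodes is a function on \<open>nat\<close> of which only the values at the
  indices \<open>0, \<dots>, N - 1\<close> (one period) are meaningful: all operations sum over \<open>{..<N}\<close>
  and all equations between mesh functions are required for indices below \<open>N\<close> only.
\<close>

definition mesh_size :: "real \<Rightarrow> real \<Rightarrow> nat \<Rightarrow> real" where
  "mesh_size a b N = (b - a) / real N"

definition mesh_point :: "real \<Rightarrow> real \<Rightarrow> nat \<Rightarrow> nat \<Rightarrow> real" where
  "mesh_point a b N j = a + real j * mesh_size a b N"

definition base_freq :: "real \<Rightarrow> real \<Rightarrow> real" where
  "base_freq a b = 2 * pi / (b - a)"

definition mode_weight :: "nat \<Rightarrow> int \<Rightarrow> real" where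
  "mode_weight N l = (if \<bar>l\<bar> < int (N div 2) then 1 else 2)"

definition trig_basis :: "real \<Rightarrow> real \<Rightarrow> nat \<Rightarrow> nat \<Rightarrow> real \<Rightarrow> complex" where
  "trig_basis a b N j x =
     (1 / of_nat N) *
     (\<Sum>l = - int (N div 2)..int (N div 2).
        complex_of_real (1 / mode_weight N l) *
        exp (\<i> * complex_of_real (of_int l * base_freq a b * (x - mesh_point a b N j))))"

text \<open>Entry \<open>(j, k)\<close> is the \<open>m\<close>-th derivative of the \<open>k\<close>-th basis function at node \<open>j\<close>.\<close>

definition diff_matrix :: "real \<Rightarrow> real \<Rightarrow> nat \<Rightarrow> nat \<Rightarrow> nat \<Rightarrow> nat \<Rightarrow> complex" where
  "diff_matrix a b N m j k =
     ((\<lambda>f x. vector_derivative f (at x)) ^^ m) (trig_basis a b N k) (mesh_point a b N j)"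

definition mat_app :: "nat \<Rightarrow> (nat \<Rightarrow> nat \<Rightarrow> complex) \<Rightarrow> (nat \<Rightarrow> complex) \<Rightarrow> nat \<Rightarrow> complex" where
  "mat_app N M U j = (\<Sum>k<N. M j k * U k)"

definition inner_h :: "real \<Rightarrow> real \<Rightarrow> nat \<Rightarrow> (nat \<Rightarrow> complex) \<Rightarrow> (nat \<Rightarrow> complex) \<Rightarrow> complex" where
  "inner_h a b N U V = complex_of_real (mesh_size a b N) * (\<Sum>j<N. U j * cnj (V j))"

text \<open>
  In the following two definitions \<open>Bs i\<close>, \<open>rs i\<close>, \<open>us i\<close>, \<open>ps i\<close> are the internal stages for
  \<open>B\<close>, \<open>\<rho>\<close>, \<open>u\<close>, \<open>\<phi>\<close> and \<open>k1 i\<close>, \<open>\<dots>\<close>, \<open>k4 i\<close> the corresponding slopes, with \<open>i \<in> {1..s}\<close>.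
  The differentiation matrices are complex-typed (with real entries), so the equations for
  the real slopes \<open>k2\<close> and \<open>k3\<close> are stated in the complex numbers.
\<close>

definition rk_slopes ::
  "real \<Rightarrow> real \<Rightarrow> real \<Rightarrow> real \<Rightarrow> real \<Rightarrow> real \<Rightarrow> real \<Rightarrow> nat \<Rightarrow>
   (nat \<Rightarrow> complex) \<Rightarrow> (nat \<Rightarrow> real) \<Rightarrow> (nat \<Rightarrow> real) \<Rightarrow> (nat \<Rightarrow> real) \<Rightarrow>
   (nat \<Rightarrow> complex) \<Rightarrow> (nat \<Rightarrow> real) \<Rightarrow> (nat \<Rightarrow> real) \<Rightarrow> (nat \<Rightarrow> real) \<Rightarrow> bool" where
  "rk_slopes \<omega> \<kappa> \<nu> \<beta> q a b N B r u p k1 k2 k3 k4 \<longleftrightarrow>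
     (\<forall>j<N.
        k1 j = \<i> * (complex_of_real \<omega> * mat_app N (diff_matrix a b N 2) B j
                    - complex_of_real (\<kappa> * (u j - \<nu> / 2 * r j + q * p j)) * B j) \<and>
        complex_of_real (k2 j) =
          mat_app N (diff_matrix a b N 1)
            (\<lambda>k. complex_of_real (- u k + \<nu> * r k - \<kappa> * p k)) j \<and>
        complex_of_real (k3 j) =
          mat_app N (diff_matrix a b N 1)
            (\<lambda>k. complex_of_real (- \<beta> * r k + \<nu> * u k + \<kappa> * \<nu> / 2 * p k)) j \<and>
        k4 j = 2 * Re (cnj (B j) * k1 j))"

definition rk_step ::
  "real \<Rightarrow> real \<Rightarrow> real \<Rightarrow> real \<Rightarrow> real \<Rightarrow> real \<Rightarrow> real \<Rightarrow> nat \<Rightarrow>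
   real \<Rightarrow> nat \<Rightarrow> (nat \<Rightarrow> nat \<Rightarrow> real) \<Rightarrow> (nat \<Rightarrow> real) \<Rightarrow>
   (nat \<Rightarrow> complex) \<Rightarrow> (nat \<Rightarrow> real) \<Rightarrow> (nat \<Rightarrow> real) \<Rightarrow> (nat \<Rightarrow> real) \<Rightarrow>
   (nat \<Rightarrow> complex) \<Rightarrow> (nat \<Rightarrow> real) \<Rightarrow> (nat \<Rightarrow> real) \<Rightarrow> (nat \<Rightarrow> real) \<Rightarrow> bool" where
  "rk_step \<omega> \<kappa> \<nu> \<beta> q a b N \<tau> s A w B r u p B' r' u' p' \<longleftrightarrow>
     (\<exists>(Bs :: nat \<Rightarrow> nat \<Rightarrow> complex) (rs :: nat \<Rightarrow> nat \<Rightarrow> real)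
       (us :: nat \<Rightarrow> nat \<Rightarrow> real) (ps :: nat \<Rightarrow> nat \<Rightarrow> real)
       (k1 :: nat \<Rightarrow> nat \<Rightarrow> complex) (k2 :: nat \<Rightarrow> nat \<Rightarrow> real)
       (k3 :: nat \<Rightarrow> nat \<Rightarrow> real) (k4 :: nat \<Rightarrow> nat \<Rightarrow> real).
       (\<forall>i\<in>{1..s}.
          rk_slopes \<omega> \<kappa> \<nu> \<beta> q a b N (Bs i) (rs i) (us i) (ps i) (k1 i) (k2 i) (k3 i) (k4 i) \<and>
          (\<forall>j<N.
             Bs i j = B j + complex_of_real \<tau> * (\<Sum>l=1..s. complex_of_real (A i l) * k1 l j) \<and>
             rs i j = r j + \<tau> * (\<Sum>l=1..s. A i l * k2 l j) \<and>
             us i j = u j + \<tau> * (\<Sum>l=1..s. A i l * k3 l j) \<and>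
             ps i j = p j + \<tau> * (\<Sum>l=1..s. A i l * k4 l j))) \<and>
       (\<forall>j<N.
          B' j = B j + complex_of_real \<tau> * (\<Sum>i=1..s. complex_of_real (w i) * k1 i j) \<and>
          r' j = r j + \<tau> * (\<Sum>i=1..s. w i * k2 i j) \<and>
          u' j = u j + \<tau> * (\<Sum>i=1..s. w i * k3 i j) \<and>
          p' j = p j + \<tau> * (\<Sum>i=1..s. w i * k4 i j)))"

end

theory Submission
  imports Defs
begin

text \<open>
  Summing an entry of \<open>diff_matrix a b N 1\<close> over its row index gives zero: the mode \<open>l = 0\<close> is killed
  by the derivative, and each mode with \<open>0 < \<bar>l\<bar> \<le> N / 2 < N\<close> sums to zero over the mesh because
  \<open>exp (2 \<pi> \<i> l / N)\<close> is a nontrivial \<open>N\<close>-th root of unity. The slopes of \<open>\<rho>\<close> and \<open>u\<close> lie in the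
  range of this matrix, so every stage contributes zero to the mean, whatever the coefficients.
\<close>

lemma sum_root_of_unity_powers:
  fixes l :: int and N :: nat
  assumes "l \<noteq> 0" "\<bar>l\<bar> < int N"
  shows "(\<Sum>j<N. exp (\<i> * complex_of_real (2 * pi * of_int l * real j / real N))) = 0"
proof -
  define z where "z = exp (\<i> * complex_of_real (2 * pi * of_int l / real N))"
  have N: "real N > 0" using assms by simp
  have pow: "exp (\<i> * complex_of_real (2 * pi * of_int l * real j / real N)) = z ^ j" for j
    unfolding z_def exp_of_nat_mult [symmetric] by (simp add: mult_ac)
  \<comment> \<open>At \<open>j = N\<close> the identity \<open>pow\<close> cancels the denominator,
    leaving an integer multiple of \<open>2 * pi\<close> in the exponent.\<close>
  have "z ^ N = exp (\<i> * complex_of_real (2 * pi * of_int l))"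
    using pow [of N] N by simp
  also have "\<dots> = 1"
    by (auto simp: exp_eq_1)
  finally have zN: "z ^ N = 1" .
  \<comment> \<open>If \<open>z = 1\<close>, then \<open>N\<close> divides \<open>l\<close>; since
    \<open>\<bar>l\<bar> < int N\<close>, this forces \<open>l = 0\<close>. With
    \<open>z \<noteq> 1\<close> the geometric sum formula applies.\<close>
  have "z \<noteq> 1"
  proof
    assume "z = 1"
    then obtain n :: int where n: "2 * pi * of_int l / real N = of_int (2 * n) * pi"
      unfolding z_def exp_eq_1 by auto
    then have "real_of_int l = of_int (n * int N)"
      using N by (simp add: field_simps)
    then have "l = n * int N"
      by (simp only: of_int_eq_iff)
    then have "\<bar>n\<bar> * int N < 1 * int N"
      using assms(2) by (simp add: abs_mult)
    then have "n = 0"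
      using N by simp
    with \<open>l = n * int N\<close> assms(1) show False by simp
  qed
  then show ?thesis
    unfolding pow using zN by (simp add: geometric_sum)
qed

text \<open>Termwise differentiation of the finite Fourier sum puts a factor
  \<open>\<i> * l * \<mu>\<close> on mode \<open>l\<close>, with
  \<open>\<mu> = base_freq a b\<close>. The formula holds at every \<open>x\<close>, so it can be
  evaluated at the nodes.\<close>

lemma vector_derivative_trig_basis:
  "vector_derivative (trig_basis a b N k) (at x) =
     1 / of_nat N *
     (\<Sum>l = - int (N div 2)..int (N div 2).
        complex_of_real (1 / mode_weight N l) *
        (\<i> * complex_of_real (of_int l * base_freq a b) *
         exp (\<i> * complex_of_real (of_int l * base_freq a b * (x - mesh_point a b N k)))))"
proof (rule vector_derivative_at)
  have exp_deriv: "((\<lambda>x. exp (\<i> * complex_of_real (c * (x - y)))) has_vector_derivative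
      (\<i> * complex_of_real c * exp (\<i> * complex_of_real (c * (x - y))))) (at x)" for c y :: real
  proof -
    have "((\<lambda>x. \<i> * complex_of_real (c * (x - y))) has_vector_derivative \<i> * complex_of_real c) (at x)"
      by (auto intro!: derivative_eq_intros)
    from field_vector_diff_chain_at [OF this DERIV_exp]
    show ?thesis by (simp add: o_def)
  qed
  show "(trig_basis a b N k has_vector_derivative
     1 / of_nat N *
     (\<Sum>l = - int (N div 2)..int (N div 2).
        complex_of_real (1 / mode_weight N l) *
        (\<i> * complex_of_real (of_int l * base_freq a b) *
         exp (\<i> * complex_of_real (of_int l * base_freq a b * (x - mesh_point a b N k)))))) (at x)"
    unfolding trig_basis_def [abs_def]
    by (intro has_vector_derivative_mult_right has_vector_derivative_sum exp_deriv)
qed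

text \<open>The mesh splits one period into \<open>N\<close> equal steps, so each step turns mode
  \<open>l\<close> by the angle \<open>2 * pi * l / N\<close>. The offset \<open>y\<close> only
  contributes a constant phase \<open>C\<close>, which factors out of the sum.\<close>

lemma sum_trig_mode_over_mesh:
  fixes l :: int
  assumes "a < b" "l \<noteq> 0" "\<bar>l\<bar> < int N"
  shows "(\<Sum>j<N. exp (\<i> * complex_of_real
           (of_int l * base_freq a b * (mesh_point a b N j - y)))) = 0"
proof -
  define C where "C = exp (\<i> * complex_of_real (of_int l * base_freq a b * (a - y)))"
  have "of_int l * base_freq a b * (mesh_point a b N j - y)
      = of_int l * base_freq a b * (a - y) + 2 * pi * of_int l * real j / real N" for j
    using assms by (simp add: mesh_point_def mesh_size_def base_freq_def field_simps)
  then have "exp (\<i> * complex_of_real (of_int l * base_freq a b * (mesh_point a b N j - y)))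
      = C * exp (\<i> * complex_of_real (2 * pi * of_int l * real j / real N))" for j
    by (simp only: C_def of_real_add distrib_left exp_add)
  then show ?thesis
    using sum_root_of_unity_powers [OF assms(2,3)] by (simp add: sum_distrib_left [symmetric])
qed

lemma diff_matrix_1_column_sum:
  assumes "a < b" "0 < N"
  shows "(\<Sum>j<N. diff_matrix a b N 1 j k) = 0"
proof -
  let ?E = "\<lambda>l j. exp (\<i> * complex_of_real
    (of_int l * base_freq a b * (mesh_point a b N j - mesh_point a b N k)))"
  let ?d = "\<lambda>l. complex_of_real (1 / mode_weight N l) * (\<i> * complex_of_real (of_int l * base_freq a b))"
  let ?L = "{- int (N div 2)..int (N div 2)}"
  have "(\<Sum>j<N. diff_matrix a b N 1 j k) = 1 / of_nat N * (\<Sum>j<N. \<Sum>l\<in>?L. ?d l * ?E l j)"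
    by (simp only: diff_matrix_def One_nat_def funpow.simps comp_def id_apply
        vector_derivative_trig_basis sum_distrib_left mult.assoc)
  also have "(\<Sum>j<N. \<Sum>l\<in>?L. ?d l * ?E l j) = (\<Sum>l\<in>?L. ?d l * (\<Sum>j<N. ?E l j))"
    by (subst sum.swap) (simp only: sum_distrib_left)
  also have "\<dots> = 0"
  proof (rule sum.neutral, rule ballI)
    fix l assume "l \<in> ?L"
    \<comment> \<open>\<open>N div 2 < N\<close> for positive \<open>N\<close>, so the extreme modes
      \<open>\<bar>l\<bar> = N div 2\<close> are covered as well.\<close>
    then have "\<bar>l\<bar> < int N" using assms(2) by auto
    then show "?d l * (\<Sum>j<N. ?E l j) = 0"
      \<comment> \<open>For \<open>l = 0\<close> the derivative factor vanishes, although the inner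
        sum is \<open>N\<close>; for every other mode the inner sum vanishes.\<close>
      using sum_trig_mode_over_mesh [OF assms(1), of l N] by (cases "l = 0") auto
  qed
  finally show ?thesis by simp
qed

text \<open>Vanishing column sums mean that the all-ones row vector annihilates the matrix from the
  left, whatever \<open>U\<close> is.\<close>

lemma sum_mat_app_diff_matrix_1:
  assumes "a < b" "0 < N"
  shows "(\<Sum>j<N. mat_app N (diff_matrix a b N 1) U j) = 0"
proof -
  have "(\<Sum>j<N. mat_app N (diff_matrix a b N 1) U j)
      = (\<Sum>k<N. (\<Sum>j<N. diff_matrix a b N 1 j k) * U k)"
    unfolding mat_app_def by (subst sum.swap) (simp only: sum_distrib_right)
  then show ?thesis
    by (simp only: diff_matrix_1_column_sum [OF assms] mult_zero_left sum.neutral_const)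
qed

text \<open>Carries the complex identity back to real slopes, since a real number with complex
  embedding zero is zero.\<close>

lemma sum_real_slope_in_range:
  fixes k :: "nat \<Rightarrow> real"
  assumes "a < b" "0 < N"
    and "\<And>j. j < N \<Longrightarrow> complex_of_real (k j) = mat_app N (diff_matrix a b N 1) U j"
  shows "(\<Sum>j<N. k j) = 0"
proof -
  have "complex_of_real (\<Sum>j<N. k j) = (\<Sum>j<N. mat_app N (diff_matrix a b N 1) U j)"
    using assms(3) by simp
  then show ?thesis
    by (simp only: sum_mat_app_diff_matrix_1 [OF assms(1,2)] of_real_eq_0_iff)
qed

text \<open>Exchanging the node and stage sums leaves each weight multiplying a zero sum. Stated for
  generic slopes \<open>k\<close>, it serves both \<open>\<rho>\<close> and
  \<open>u\<close>.\<close>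

lemma sum_rk_update:
  fixes r r' w :: "nat \<Rightarrow> real"
  assumes "\<And>j. j < N \<Longrightarrow> r' j = r j + \<tau> * (\<Sum>i=1..s. w i * k i j)"
    and "\<And>i. i \<in> {1..s} \<Longrightarrow> (\<Sum>j<N. k i j) = 0"
  shows "(\<Sum>j<N. r' j) = (\<Sum>j<N. r j)"
proof -
  have "(\<Sum>j<N. r' j) = (\<Sum>j<N. r j) + \<tau> * (\<Sum>j<N. \<Sum>i=1..s. w i * k i j)"
    using assms(1) by (simp add: sum.distrib sum_distrib_left)
  also have "(\<Sum>j<N. \<Sum>i=1..s. w i * k i j) = (\<Sum>i=1..s. w i * (\<Sum>j<N. k i j))"
    by (subst sum.swap) (simp only: sum_distrib_left)
  also have "\<dots> = 0"
    using assms(2) by simp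
  finally show ?thesis by simp
qed

lemma rk_step_sums:
  assumes "a < b" "0 < N"
    and "rk_step \<omega> \<kappa> \<nu> \<beta> q a b N \<tau> s A w B r u p B' r' u' p'"
  shows "(\<Sum>j<N. r' j) = (\<Sum>j<N. r j)" "(\<Sum>j<N. u' j) = (\<Sum>j<N. u j)"
proof -
  obtain Bs rs us ps k1 k2 k3 k4 where
    slopes: "\<And>i. i \<in> {1..s} \<Longrightarrow>
      rk_slopes \<omega> \<kappa> \<nu> \<beta> q a b N (Bs i) (rs i) (us i) (ps i) (k1 i) (k2 i) (k3 i) (k4 i)"
    and r': "\<And>j. j < N \<Longrightarrow> r' j = r j + \<tau> * (\<Sum>i=1..s. w i * k2 i j)"
    and u': "\<And>j. j < N \<Longrightarrow> u' j = u j + \<tau> * (\<Sum>i=1..s. w i * k3 i j)"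
    using assms(3) unfolding rk_step_def by blast
  \<comment> \<open>The flux inside \<open>mat_app\<close> takes the place of \<open>U\<close>, so
    the implicit stage equations need not be solved.\<close>
  have "(\<Sum>j<N. k2 i j) = 0" if "i \<in> {1..s}" for i
    using slopes [OF that] unfolding rk_slopes_def
    by (intro sum_real_slope_in_range [OF assms(1,2)]) blast
  with r' show "(\<Sum>j<N. r' j) = (\<Sum>j<N. r j)" by (rule sum_rk_update)
  have "(\<Sum>j<N. k3 i j) = 0" if "i \<in> {1..s}" for i
    using slopes [OF that] unfolding rk_slopes_def
    by (intro sum_real_slope_in_range [OF assms(1,2)]) blast
  with u' show "(\<Sum>j<N. u' j) = (\<Sum>j<N. u j)" by (rule sum_rk_update)
qed

text \<open>Conjugation fixes the all-ones vector, so conservation of the invariant reduces to that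
  of the plain sum of entries.\<close>

lemma inner_h_of_real_one:
  "inner_h a b N (\<lambda>j. complex_of_real (r j)) (\<lambda>j. 1)
     = complex_of_real (mesh_size a b N * (\<Sum>j<N. r j))"
  by (simp add: inner_h_def)

theorem theorem3p4:
  fixes \<omega> \<kappa> \<nu> \<beta> q a b \<tau> :: real
    and N s :: nat
    and A :: "nat \<Rightarrow> nat \<Rightarrow> real"
    and w :: "nat \<Rightarrow> real"
    and B :: "nat \<Rightarrow> nat \<Rightarrow> complex"
    and \<rho> u \<phi> :: "nat \<Rightarrow> nat \<Rightarrow> real"
  assumes "\<beta> \<noteq> \<nu>^2"
    and "q = \<kappa> + \<nu> * (\<kappa> * \<nu> - 1) / (4 * (\<beta> - \<nu>^2))"
    and "a < b"
    and "0 < N" and "even N"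
    and "0 < \<tau>"
    and "1 \<le> s"
    and scheme: "\<And>n. rk_step \<omega> \<kappa> \<nu> \<beta> q a b N \<tau> s A w
           (B n) (\<rho> n) (u n) (\<phi> n) (B (Suc n)) (\<rho> (Suc n)) (u (Suc n)) (\<phi> (Suc n))"
  shows "\<forall>n. inner_h a b N (\<lambda>j. complex_of_real (\<rho> (Suc n) j)) (\<lambda>j. 1)
              = inner_h a b N (\<lambda>j. complex_of_real (\<rho> n j)) (\<lambda>j. 1)
           \<and> inner_h a b N (\<lambda>j. complex_of_real (u (Suc n) j)) (\<lambda>j. 1)
              = inner_h a b N (\<lambda>j. complex_of_real (u n j)) (\<lambda>j. 1)"
  using rk_step_sums [OF \<open>a < b\<close> \<open>0 < N\<close> scheme] by (simp only: inner_h_of_real_one simp_thms)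

end
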